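(* Samuels' conjecture implies Feige's conjecture. That is, suppose that for every integer $n \ge 1$, all real numbers $\mu_1 \ge \dotsc \ge \mu_n > 0$ with $\mu_1 + \dotsb + \mu_n = 1$, every real $\delta > 0$, and all independent non-negative random variables $X_1, \dotsc, X_n$ with $EX_1 = \dotsc = EX_n = 1$, one has, with $Z = \sum_{i=1}^n \mu_i X_i$ and $T = 1 + \delta$, \[ P(Z < T) \ge \min_{1 \le i \le n} \prod_{j=1}^i \left(1 - \frac{\mu_j}{T - \sum_{k=i+1}^n \mu_k}\right). \] Then for every integer $n \ge 1$, all real numbers $\mu_1 \ge \dotsc \ge \mu_n > 0$ with $\mu_1 + \dotsb + \mu_n = 1$, every real $\delta > 0$, and all independent non-negative random variables $X_1, \dotsc, X_n$ with $EX_1 = \dotsc = EX_n = 1$, one has, with $Z = \sum_{i=1}^n \mu_i X_i$, $T = 1 + \delta$ and $M = \max_{1 \le i \le n} \mu_i = \mu_1$, \[ P(Z < T) \ge \min\left(\frac{\delta}{\delta + M}, \frac{1}{e}\right). \]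
   Context: $P$ denotes probability, $E$ denotes expectation, and $e$ is the base of the natural logarithm. The empty sum (for $i = n$, $\sum_{k=n+1}^n \mu_k$) is $0$. The first displayed inequality, asserted for all such data, is Samuels' conjecture; the second, asserted for all such data, is Feige's conjecture. Only the implication is claimed, not either conjecture itself. *)

theory Defs
  imports "HOL-Probability.Probability"
begin

definition admissible ::
  "nat \<Rightarrow> (nat \<Rightarrow> real) \<Rightarrow> real \<Rightarrow> 'a measure \<Rightarrow> (nat \<Rightarrow> 'a \<Rightarrow> real) \<Rightarrow> bool" where
  "admissible n \<mu> \<delta> \<Omega> X \<longleftrightarrow>
     n \<ge> 1 \<and>
     (\<forall>i\<in>{1..n}. \<forall>j\<in>{1..n}. i \<le> j \<longrightarrow> \<mu> i \<ge> \<mu> j) \<and>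
     (\<forall>i\<in>{1..n}. \<mu> i > 0) \<and>
     (\<Sum>i=1..n. \<mu> i) = 1 \<and>
     \<delta> > 0 \<and>
     prob_space \<Omega> \<and>
     prob_space.indep_vars \<Omega> (\<lambda>_. borel) X {1..n} \<and>
     (\<forall>i\<in>{1..n}. \<forall>\<omega>\<in>space \<Omega>. X i \<omega> \<ge> 0) \<and>
     (\<forall>i\<in>{1..n}. integrable \<Omega> (X i) \<and> prob_space.expectation \<Omega> (X i) = 1)"

text \<open>
  HOL cannot quantify over types inside a formula, so each conjecture is a family of
  propositions indexed by the type of sample points. Every member quantifies over all
  probability spaces on that type. The member at \<open>nat \<Rightarrow> real\<close> already amounts to the full
  conjecture, since only the joint law of finitely many real random variables matters.
  An implication between members that is polymorphic in the type yields the implication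
  between the conjectures over all probability spaces.
\<close>

definition samuels_conjecture :: "'a itself \<Rightarrow> bool" where
  "samuels_conjecture TYPE('a) \<longleftrightarrow>
     (\<forall>n \<mu> \<delta> (\<Omega> :: 'a measure) X. admissible n \<mu> \<delta> \<Omega> X \<longrightarrow>
        (let Z = (\<lambda>\<omega>. \<Sum>i=1..n. \<mu> i * X i \<omega>); T = 1 + \<delta> in
           \<P>(\<omega> in \<Omega>. Z \<omega> < T) \<ge>
             (MIN i\<in>{1..n}. \<Prod>j=1..i. (1 - \<mu> j / (T - (\<Sum>k=i+1..n. \<mu> k))))))"

definition feige_conjecture :: "'a itself \<Rightarrow> bool" where
  "feige_conjecture TYPE('a) \<longleftrightarrow>
     (\<forall>n \<mu> \<delta> (\<Omega> :: 'a measure) X. admissible n \<mu> \<delta> \<Omega> X \<longrightarrow>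
        (let Z = (\<lambda>\<omega>. \<Sum>i=1..n. \<mu> i * X i \<omega>); T = 1 + \<delta>; M = (MAX i\<in>{1..n}. \<mu> i) in
           \<P>(\<omega> in \<Omega>. Z \<omega> < T) \<ge> min (\<delta> / (\<delta> + M)) (1 / exp 1)))"

end

theory Submission
  imports Defs
begin

text \<open>
  Only the right-hand sides need comparing. Put \<open>S = \<mu>\<^sub>1 + \<dots> + \<mu>\<^sub>i\<close>, so that the \<open>i\<close>-th
  denominator is \<open>\<delta> + S\<close>. Since \<open>exp\<close> is convex and \<open>\<mu>\<^sub>j \<le> M\<close>, each factor is at least
  \<open>(1 - M / (\<delta> + S)) powr (\<mu>\<^sub>j / M)\<close>, and the \<open>i\<close>-th product is at least \<open>exp (- x L (a + x))\<close>,
  where \<open>x = S / M \<ge> 1\<close>, \<open>a = \<delta> / M\<close> and \<open>L y = ln (y / (y - 1))\<close>. Because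
  \<open>L y \<le> 1 / sqrt (y (y - 1))\<close>, the function \<open>1 / L y - y\<close> is nondecreasing. Comparing its values
  at \<open>a + 1\<close> and \<open>a + x\<close> gives \<open>x L (a + x) \<le> max 1 (L (a + 1))\<close>, and
  \<open>exp (- L (a + 1)) = \<delta> / (\<delta> + M)\<close>.
\<close>

text \<open>The difference of the two sides vanishes at \<open>1\<close> and has derivative
  \<open>(1 - 1 / t)\<^sup>2\<close>.\<close>

lemma two_ln_le_diff_inverse:
  fixes s :: real
  assumes "s \<ge> 1"
  shows "2 * ln s \<le> s - 1 / s"
proof -
  have "1 - 1 / 1 - 2 * ln (1::real) \<le> s - 1 / s - 2 * ln s"
  proof (rule DERIV_nonneg_imp_nondecreasing[OF assms])
    fix t :: real assume t: "1 \<le> t" "t \<le> s"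
    have "((\<lambda>s. s - 1 / s - 2 * ln s) has_real_derivative (1 - 1 / t)\<^sup>2) (at t)"
      using t by (auto intro!: derivative_eq_intros simp: field_simps power2_eq_square)
    then show "\<exists>D. ((\<lambda>s. s - 1 / s - 2 * ln s) has_real_derivative D) (at t) \<and> 0 \<le> D"
      using zero_le_power2 by blast
  qed
  then show ?thesis by simp
qed

text \<open>For \<open>s = sqrt (y / (y - 1))\<close> the bound
  \<open>2 * ln s \<le> s - 1 / s\<close> has right-hand side exactly
  \<open>1 / sqrt (y * (y - 1))\<close>; squaring removes the root.\<close>

lemma ln_ratio_squared_le:
  fixes y :: real
  assumes "y > 1"
  shows "(ln (y / (y - 1)))\<^sup>2 \<le> 1 / (y * (y - 1))"
proof -
  define t where "t = y / (y - 1)"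
  define s where "s = sqrt t"
  have t: "t > 1" using assms by (simp add: t_def field_simps)
  then have s: "s > 1" "s\<^sup>2 = t" by (auto simp: s_def)
  have "ln t = 2 * ln s" using s by (metis ln_realpow of_nat_numeral less_trans zero_less_one)
  then have "ln t \<le> s - 1 / s" using two_ln_le_diff_inverse s by simp
  then have "(ln t)\<^sup>2 \<le> (s - 1 / s)\<^sup>2" using t by (intro power_mono) auto
  also have "\<dots> = s\<^sup>2 - 2 + 1 / s\<^sup>2" using s by (simp add: power2_diff power_divide)
  also have "\<dots> = 1 / (y * (y - 1))"
    unfolding s t_def using assms by (simp add: divide_simps) (simp add: algebra_simps)
  finally show ?thesis by (simp add: t_def)
qed

text \<open>Since \<open>ln (t / (t - 1))\<close> has derivative \<open>- 1 / (t * (t - 1))\<close>,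
  the sign of the derivative here is precisely the preceding bound on the squared logarithm.\<close>

lemma inverse_ln_ratio_minus_mono:
  fixes y z :: real
  assumes "1 < y" "y \<le> z"
  shows "1 / ln (y / (y - 1)) - y \<le> 1 / ln (z / (z - 1)) - z"
proof (rule DERIV_nonneg_imp_nondecreasing[OF assms(2)])
  fix t assume "y \<le> t" "t \<le> z"
  with assms have t: "t > 1" by simp
  define L where "L = ln (t / (t - 1))"
  have L: "L > 0" using t by (auto simp: L_def intro!: ln_gt_zero)
  have "((\<lambda>y. 1 / ln (y / (y - 1)) - y) has_real_derivative
          1 / (t * (t - 1)) / L\<^sup>2 - 1) (at t)"
    using t L unfolding L_def
    by (auto intro!: derivative_eq_intros simp: power2_eq_square)
  moreover have "L\<^sup>2 \<le> 1 / (t * (t - 1))"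
    using ln_ratio_squared_le[OF t] by (simp add: L_def)
  then have "0 \<le> 1 / (t * (t - 1)) / L\<^sup>2 - 1"
    using L by (simp add: le_divide_eq_1_pos del: divide_divide_eq_left)
  ultimately show "\<exists>D. ((\<lambda>y. 1 / ln (y / (y - 1)) - y) has_real_derivative D) (at t) \<and> 0 \<le> D"
    by blast
qed

lemma mult_ln_ratio_le_max:
  fixes a x :: real
  assumes "a > 0" "x \<ge> 1"
  shows "x * ln ((a + x) / (a + x - 1)) \<le> max 1 (ln ((a + 1) / a))"
proof -
  define K where "K = ln ((a + 1) / a)"
  define L where "L = ln ((a + x) / (a + x - 1))"
  have K: "K > 0" using assms by (auto simp: K_def intro!: ln_gt_zero)
  have L: "L > 0" using assms by (auto simp: L_def intro!: ln_gt_zero)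
  have "1 / K - (a + 1) \<le> 1 / L - (a + x)"
    using inverse_ln_ratio_minus_mono[of "a + 1" "a + x"] assms by (simp add: K_def L_def)
  then have "L * (1 / K + x - 1) \<le> L * (1 / L)"
    using L by (intro mult_left_mono) auto
  then have le: "L * (1 / K + x - 1) \<le> 1" using L by simp
  show ?thesis
  proof (cases "K \<le> 1")
    \<comment> \<open>Here \<open>1 / K \<ge> 1\<close>, so \<open>1 / K + x - 1\<close> dominates
      \<open>x\<close> and \<open>x * L \<le> 1\<close>.\<close>
    case True
    then have "L * x \<le> L * (1 / K + x - 1)"
      using K L by (intro mult_left_mono) auto
    with le show ?thesis by (simp add: L_def mult.commute)
  next
    case False
    \<comment> \<open>Here \<open>1 / K < 1\<close>, so \<open>x / K = 1 / K + (x - 1) / K\<close>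
      is at most \<open>1 / K + x - 1\<close>.\<close>
    then have "(x - 1) * (1 / K) \<le> (x - 1) * 1"
      using assms by (intro mult_left_mono) auto
    then have "x / K \<le> 1 / K + x - 1" by (simp add: algebra_simps diff_divide_distrib)
    then have "L * (x / K) \<le> L * (1 / K + x - 1)" using L by (intro mult_left_mono) auto
    with le have "L * (x / K) \<le> 1" by linarith
    then have "x * L \<le> K" using K by (simp add: field_simps)
    then show ?thesis by (simp add: K_def L_def)
  qed
qed

text \<open>Bernoulli's inequality for \<open>(1 - c) powr u\<close>: the graph of
  \<open>exp\<close> lies below its chord between \<open>0\<close> and \<open>ln (1 - c)\<close>.
  The exponential form lets a product of such bounds become a sum of exponents.\<close>

lemma exp_le_one_minus:
  fixes c u :: real
  assumes "c < 1" "0 \<le> u" "u \<le> 1"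
  shows "exp (u * ln (1 - c)) \<le> 1 - u * c"
proof -
  have "exp ((1 - u) *\<^sub>R 0 + u *\<^sub>R ln (1 - c)) \<le> (1 - u) * exp 0 + u * exp (ln (1 - c))"
    using assms by (intro convex_onD[OF exp_convex]) auto
  then show ?thesis using assms by (simp add: algebra_simps)
qed

lemma prod_one_minus_ge_min:
  fixes \<mu> :: "'b \<Rightarrow> real"
  assumes "M > 0" "\<delta> > 0"
    and bounds: "\<And>j. j \<in> J \<Longrightarrow> 0 \<le> \<mu> j" "\<And>j. j \<in> J \<Longrightarrow> \<mu> j \<le> M"
    and "M \<le> sum \<mu> J"
  shows "(\<Prod>j\<in>J. 1 - \<mu> j / (\<delta> + sum \<mu> J)) \<ge> min (\<delta> / (\<delta> + M)) (1 / exp 1)"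
proof -
  define S where "S = sum \<mu> J"
  define a where "a = \<delta> / M"
  define x where "x = S / M"
  define L where "L = ln ((a + x) / (a + x - 1))"
  \<comment> \<open>An infinite \<open>J\<close> would give the default sum \<open>0\<close>,
    contradicting \<open>0 < M \<le> sum \<mu> J\<close>.\<close>
  have S: "S \<ge> M" and J: "finite J"
    using assms sum.infinite[of J \<mu>] by (auto simp: S_def intro: ccontr)
  have ax: "a > 0" "x \<ge> 1" using assms S by (auto simp: a_def x_def)
  have "1 - M / (\<delta> + S) = inverse ((a + x) / (a + x - 1))"
  proof -
    have "a + x - 1 = (\<delta> + S - M) / M" "a + x = (\<delta> + S) / M"
      using assms by (simp_all add: a_def x_def diff_divide_distrib add_divide_distrib)
    moreover have "\<delta> + S > 0" using assms S by linarith
    ultimately show ?thesis using \<open>M > 0\<close>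
      by (simp add: diff_divide_distrib right_diff_distrib)
  qed
  then have lnL: "ln (1 - M / (\<delta> + S)) = - L"
    using ax by (simp add: L_def ln_inverse del: inverse_divide)
  have "min (\<delta> / (\<delta> + M)) (1 / exp 1) = exp (- max 1 (ln ((a + 1) / a)))"
  proof -
    have "exp (- ln ((a + 1) / a)) = \<delta> / (\<delta> + M)"
      using ax assms by (simp add: exp_minus) (simp add: a_def field_simps)
    moreover have "exp (- 1) = 1 / exp (1::real)" by (simp add: exp_minus inverse_eq_divide)
    ultimately show ?thesis
      by (metis exp_le_cancel_iff max_def min_def neg_le_iff_le min.commute)
  qed
  also have "\<dots> \<le> exp (- (x * L))"
    using mult_ln_ratio_le_max[OF ax] by (simp add: L_def)
  \<comment> \<open>The weights \<open>\<mu> j / M\<close> add up to \<open>x\<close>.\<close>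
  also have "\<dots> = (\<Prod>j\<in>J. exp (\<mu> j / M * - L))"
    using J by (simp add: exp_sum[symmetric] sum_negf sum_distrib_right[symmetric]
        sum_divide_distrib[symmetric] x_def S_def)
  also have "\<dots> \<le> (\<Prod>j\<in>J. 1 - \<mu> j / (\<delta> + S))"
  proof (rule prod_mono, safe)
    fix j assume "j \<in> J"
    \<comment> \<open>Take \<open>u = \<mu> j / M\<close> and \<open>c = M / (\<delta> + S)\<close>,
      so that \<open>M\<close> cancels in \<open>u * c\<close>; \<open>c < 1\<close> follows from
      \<open>S \<ge> M\<close> and \<open>\<delta> > 0\<close>.\<close>
    then show "exp (\<mu> j / M * - L) \<le> 1 - \<mu> j / (\<delta> + S)"
      using exp_le_one_minus[of "M / (\<delta> + S)" "\<mu> j / M"] bounds assms S lnL by simp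
  qed simp
  finally show ?thesis by (simp add: S_def)
qed

theorem theorem1p1:
  assumes "samuels_conjecture TYPE('a)"
  shows "feige_conjecture TYPE('a)"
  unfolding feige_conjecture_def Let_def
proof (intro allI impI)
  fix n \<mu> \<delta> and \<Omega> :: "'a measure" and X
  assume adm: "admissible n \<mu> \<delta> \<Omega> X"
  define M where "M = (MAX i\<in>{1..n}. \<mu> i)"
  have n: "n \<ge> 1" and anti: "\<And>i j. 1 \<le> i \<Longrightarrow> i \<le> j \<Longrightarrow> j \<le> n \<Longrightarrow> \<mu> j \<le> \<mu> i"
    and pos: "\<And>i. i \<in> {1..n} \<Longrightarrow> \<mu> i > 0" and sum1: "(\<Sum>i=1..n. \<mu> i) = 1" and \<delta>: "\<delta> > 0"
    using adm by (auto simp: admissible_def)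
  have M: "M = \<mu> 1"
    unfolding M_def using n by (intro Max_eqI) (auto intro: anti)
  have "min (\<delta> / (\<delta> + M)) (1 / exp 1) \<le>
      (MIN i\<in>{1..n}. \<Prod>j=1..i. (1 - \<mu> j / (1 + \<delta> - (\<Sum>k=i+1..n. \<mu> k))))"
  proof (rule Min.boundedI)
    fix q assume "q \<in> (\<lambda>i. \<Prod>j=1..i. (1 - \<mu> j / (1 + \<delta> - (\<Sum>k=i+1..n. \<mu> k)))) ` {1..n}"
    then obtain i where i: "1 \<le> i" "i \<le> n"
      and q: "q = (\<Prod>j=1..i. (1 - \<mu> j / (1 + \<delta> - (\<Sum>k=i+1..n. \<mu> k))))"
      by auto
    \<comment> \<open>As the total is \<open>1\<close>, subtracting the tail from
      \<open>1 + \<delta>\<close> leaves \<open>\<delta>\<close> plus the initial sum.\<close>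
    have "sum \<mu> {1..n} = sum \<mu> {1..i} + sum \<mu> {i+1..n}"
      using i sum.ub_add_nat[of 1 i \<mu> "n - i"] by simp
    then have denom: "1 + \<delta> - (\<Sum>k=i+1..n. \<mu> k) = \<delta> + sum \<mu> {1..i}"
      using sum1 by simp
    \<comment> \<open>The largest weight \<open>\<mu> 1\<close> is a summand of every initial
      sum.\<close>
    have "M \<le> sum \<mu> {1..i}"
      unfolding M using i by (intro member_le_sum) (auto intro!: less_imp_le pos)
    then show "min (\<delta> / (\<delta> + M)) (1 / exp 1) \<le> q"
      unfolding q denom using i n \<delta> pos
      by (intro prod_one_minus_ge_min) (auto simp: M intro!: less_imp_le[OF pos] anti)
  qed (use n in auto)
  also have "\<dots> \<le> \<P>(\<omega> in \<Omega>. (\<Sum>i=1..n. \<mu> i * X i \<omega>) < 1 + \<delta>)"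
    using assms adm unfolding samuels_conjecture_def Let_def by blast
  finally show "\<P>(\<omega> in \<Omega>. (\<Sum>i=1..n. \<mu> i * X i \<omega>) < 1 + \<delta>) \<ge>
      min (\<delta> / (\<delta> + (MAX i\<in>{1..n}. \<mu> i))) (1 / exp 1)"
    by (simp add: M_def)
qed

end
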